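(* Let $\mathbb F$ be a field of characteristic different from $2$ and $3$, let $G=\mathbb Z_2^3$, let $V=\mathbb F^4$, $W=\mathbb F^3$, $S=\langle(1,1,1)\rangle^\perp=\{(a_1,a_2,a_3)\in W:a_1+a_2+a_3=0\}$, and consider the Lie algebras $V^\sigma[G]$, $W^\sigma[G]$, $S^\sigma[G]$ defined by the twists in the context. For a Lie algebra $\mathfrak L$ let $\kappa\colon\mathfrak L\times\mathfrak L\to\mathbb F$, $\kappa(x,y)=\mathrm{tr}(\mathrm{ad}(x)\,\mathrm{ad}(y))$, be its Killing form, where $\mathrm{ad}$ is the adjoint operator. (1) If $\mathfrak L=V^\sigma[G]$, then $\kappa(rg_i,sg_j)=-12\langle r,s\rangle\delta_{ij}$ for any $i,j\in I$, $r,s\in V$. (2) If $\mathfrak L=W^\sigma[G]$, then $\kappa(rg_i,sg_j)=-10\langle r,s\rangle\delta_{ij}$ for any $i,j\in I$, $r,s\in W$. (3) If $\mathfrak L=S^\sigma[G]$, then $\kappa(rg_i,sg_j)=-8\langle r,s\rangle\delta_{ij}$ for any $i,j\in I$, $r,s\in S$. In the three cases, the neutral component $\mathfrak L_{g_0}=\{rg_0\}$ (with $r$ ranging over $V$, $W$, $S$ respectively) coincides with the radical of $\kappa$.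
   Context: Generalized group algebra: for an abelian group $(G,+)$, an $\mathbb F$-vector space $V$ and a map (twist) $\sigma\colon G\times G\to\mathrm{Bil}(V\times V,V)$, $(g,h)\mapsto\sigma_{g,h}$ (with $\mathrm{Bil}(V\times V,V)$ the space of bilinear maps), $V^\sigma[G]$ is the vector space of formal sums $\sum_{g\in G}r_g g$, $r_g\in V$, with product obtained by bilinear extension from $[rg,sh]=\sigma_{g,h}(r,s)(g+h)$. Labelling of $G=\mathbb Z_2^3$: $g_0=(0,0,0)$, $g_1=(1,0,0)$, $g_2=(0,1,0)$, $g_3=(0,0,1)$, $g_4=(1,1,0)$, $g_5=(0,1,1)$, $g_6=(1,1,1)$, $g_7=(1,0,1)$. With $I=\{1,\dots,7\}$, sums of indices such as $i+1$ (with $i\in I$) are taken modulo $7$ with values in $I$ (residue $0$ is represented by $7$; the index $0$ is distinct and denotes the neutral element). $\delta_{ij}$ is the Kronecker delta, and $\langle r,s\rangle=\sum_k a_kb_k$ is the standard bilinear form on $\mathbb F^4$ or $\mathbb F^3$ (restricted to $S$ in case (3)). Twist on $V=\mathbb F^4$, with $\sigma_{i,j}:=\sigma(g_i,g_j)$, $r=(a_1,a_2,a_3,a_4)$, $s=(b_1,b_2,b_3,b_4)$, $i\in I$: $\sigma_{i,i+1}(r,s)=(-a_2b_1-a_3b_3,-a_2b_3-a_3b_1,a_1b_2+a_4b_4,a_1b_4+a_4b_2)$, $\sigma_{i,i+2}(r,s)=(a_2b_3+a_4b_4,-a_1b_1-a_3b_2,-a_1b_2-a_3b_1,a_2b_4+a_4b_3)$,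 $\sigma_{i,i+4}(r,s)=(-a_1b_2-a_2b_3,a_3b_1+a_4b_4,-a_1b_3-a_2b_2,a_3b_4+a_4b_1)$, $\sigma_{0,i}=\sigma_{i,0}=\sigma_{0,0}=\sigma_{i,i}=0$, and $\sigma_{i,i+3}(r,s)=-\sigma_{i,i+4}(s,r)$, $\sigma_{i,i+5}(r,s)=-\sigma_{i,i+2}(s,r)$, $\sigma_{i,i+6}(r,s)=-\sigma_{i,i+1}(s,r)$. Twist on $W=\mathbb F^3$, with $r=(a_1,a_2,a_3)$, $s=(b_1,b_2,b_3)$, $i\in I$: $\sigma_{i,i+1}(r,s)=(-a_2b_1-a_3b_3,-a_2b_3-a_3b_1,a_1b_2)$, $\sigma_{i,i+2}(r,s)=(a_2b_3,-a_1b_1-a_3b_2,-a_1b_2-a_3b_1)$, $\sigma_{i,i+4}(r,s)=(-a_1b_2-a_2b_3,a_3b_1,-a_1b_3-a_2b_2)$, $\sigma_{0,i}=\sigma_{i,0}=\sigma_{0,0}=\sigma_{i,i}=0$, and $\sigma_{i,i+3}(r,s)=-\sigma_{i,i+4}(s,r)$, $\sigma_{i,i+5}(r,s)=-\sigma_{i,i+2}(s,r)$, $\sigma_{i,i+6}(r,s)=-\sigma_{i,i+1}(s,r)$. The twist on $S$ is the restriction of the twist on $W$ (which satisfies $\sigma_{g,h}(S,S)\subset S$ for all $g,h\in G$). All three generalized group algebras are Lie algebras.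
   Formalization: For W the equality of the neutral component with the radical of κ is stated only in characteristic different from 5; in characteristic 5 one has -10 = 0, so κ = 0 and its radical is the whole algebra, and only the inclusion in the radical is stated there. *)

theory Defs
  imports
    "HOL-Analysis.Analysis"
    "HOL-Library.Poly_Mapping"
    "HOL-Library.Z2"
begin

section \<open>Trace, Killing form and radical on a subspace\<close>

text \<open>
  Trace of an endomorphism of the finite-dimensional subspace \<open>U\<close>: the sum of the diagonal
  entries of its matrix with respect to some basis of \<open>U\<close>. The map is given as a function on
  the ambient type; by lemma \<open>trace_on_eq\<close> below every basis gives the same value.
\<close>

definition trace_on :: "('a::field \<Rightarrow> 'b::ab_group_add \<Rightarrow> 'b) \<Rightarrow> 'b set \<Rightarrow> ('b \<Rightarrow> 'b) \<Rightarrow> 'a" where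
  "trace_on scl U f =
     (let B = (SOME B. module.independent scl B \<and> module.span scl B = U)
      in \<Sum>b\<in>B. module.representation scl B (f b) b)"

context vector_space
begin

lemma trace_basis_independent:
  assumes B: "independent B" "span B = U" "finite B"
    and C: "independent C" "span C = U" "finite C"
    and f: "Vector_Spaces.linear scale scale f" "f ` U \<subseteq> U"
  shows "(\<Sum>b\<in>B. representation B (f b) b) = (\<Sum>c\<in>C. representation C (f c) c)"
proof -
  interpret f: Vector_Spaces.linear scale scale f by (rule f(1))
  have BU: "b \<in> U" "f b \<in> U" if "b \<in> B" for b
    using that B(2) f(2) span_base by auto
  have CU: "c \<in> U" "f c \<in> U" if "c \<in> C" for c
    using that C(2) f(2) span_base by auto
  have "representation B (f b) b = (\<Sum>c\<in>C. representation C b c * representation B (f c) b)"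
    if "b \<in> B" for b
  proof -
    have "f b = f (\<Sum>c\<in>C. scale (representation C b c) c)"
      using sum_representation_eq[of C b C] C BU[OF that] by simp
    also have "\<dots> = (\<Sum>c\<in>C. scale (representation C b c) (f c))"
      by (simp add: f.sum f.scale)
    finally have "f b = (\<Sum>c\<in>C. scale (representation C b c) (f c))" .
    moreover have "f c \<in> span B" if "c \<in> C" for c
      using B(2) CU that by simp
    ultimately show ?thesis
      using B(1) by (simp add: representation_sum representation_scale span_scale)
  qed
  then have "(\<Sum>b\<in>B. representation B (f b) b) =
      (\<Sum>b\<in>B. \<Sum>c\<in>C. representation C b c * representation B (f c) b)"
    by simp
  also have "\<dots> = (\<Sum>c\<in>C. \<Sum>b\<in>B. representation B (f c) b * representation C b c)"
    by (subst sum.swap) (simp add: mult.commute)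
  also have "\<dots> = (\<Sum>c\<in>C. representation C (f c) c)"
  proof (rule sum.cong)
    fix c assume c: "c \<in> C"
    have "f c = (\<Sum>b\<in>B. scale (representation B (f c) b) b)"
      using sum_representation_eq[of B "f c" B] B CU[OF c] by simp
    then have "representation C (f c) c =
        representation C (\<Sum>b\<in>B. scale (representation B (f c) b) b) c"
      by (rule arg_cong)
    also have "\<dots> = (\<Sum>b\<in>B. representation B (f c) b * representation C b c)"
    proof -
      have "b \<in> span C" if "b \<in> B" for b
        using C(2) BU that by simp
      then show ?thesis
        using C(1) by (simp add: representation_sum representation_scale span_scale)
    qed
    finally show "(\<Sum>b\<in>B. representation B (f c) b * representation C b c) =
        representation C (f c) c"
      by simp
  qed simp
  finally show ?thesis .
qed

lemma trace_on_eq: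
  assumes B: "independent B" "span B = U" "finite B"
    and f: "Vector_Spaces.linear scale scale f" "f ` U \<subseteq> U"
  shows "trace_on scale U f = (\<Sum>b\<in>B. representation B (f b) b)"
proof -
  define C where "C = (SOME C. independent C \<and> span C = U)"
  have C: "independent C \<and> span C = U"
    unfolding C_def by (rule someI[of _ B]) (use B in simp)
  then have "C \<subseteq> span B"
    using B(2) span_base by auto
  then have "finite C"
    using independent_span_bound[of B C] B(3) C by simp
  then have "(\<Sum>b\<in>C. representation C (f b) b) = (\<Sum>b\<in>B. representation B (f b) b)"
    using trace_basis_independent[of C U B f] C B f by simp
  then show ?thesis
    by (simp add: trace_on_def C_def[symmetric])
qed

end

definition killing_form ::
  "('a::field \<Rightarrow> 'b::ab_group_add \<Rightarrow> 'b) \<Rightarrow> 'b set \<Rightarrow> ('b \<Rightarrow> 'b \<Rightarrow> 'b) \<Rightarrow> 'b \<Rightarrow> 'b \<Rightarrow> 'a" where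
  "killing_form scl L br x y = trace_on scl L (br x \<circ> br y)"

definition form_radical :: "'b set \<Rightarrow> ('b \<Rightarrow> 'b \<Rightarrow> 'a::zero) \<Rightarrow> 'b set" where
  "form_radical L \<kappa> = {x \<in> L. \<forall>y\<in>L. \<kappa> x y = 0}"


section \<open>Generalized group algebras\<close>

text \<open>
  The formal sums over \<open>G\<close> with coefficients in \<open>V\<close> are the finitely supported functions
  \<open>'g \<Rightarrow>\<^sub>0 'v\<close>; the formal sum written \<open>r g\<close> is \<open>Poly_Mapping.single g r\<close>.
\<close>

definition gga_bracket ::
  "('g \<Rightarrow> 'g \<Rightarrow> 'v \<Rightarrow> 'v \<Rightarrow> 'v) \<Rightarrow> ('g::ab_group_add \<Rightarrow>\<^sub>0 'v::ab_group_add) \<Rightarrow> ('g \<Rightarrow>\<^sub>0 'v) \<Rightarrow> ('g \<Rightarrow>\<^sub>0 'v)"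
  where "gga_bracket \<sigma> x y =
    (\<Sum>g\<in>Poly_Mapping.keys x. \<Sum>h\<in>Poly_Mapping.keys y.
       Poly_Mapping.single (g + h) (\<sigma> g h (Poly_Mapping.lookup x g) (Poly_Mapping.lookup y h)))"

text \<open>Formal sums with coefficients in a subspace of \<open>'v\<close>.\<close>

definition gga_space :: "'v set \<Rightarrow> ('g \<Rightarrow>\<^sub>0 'v::zero) set" where
  "gga_space U = {x. \<forall>g. Poly_Mapping.lookup x g \<in> U}"

definition gga_scale :: "'a::field \<Rightarrow> ('g \<Rightarrow>\<^sub>0 'a^'n) \<Rightarrow> ('g \<Rightarrow>\<^sub>0 'a^'n)" where
  "gga_scale c x = Poly_Mapping.map ((*s) c) x"

lemma lookup_gga_scale: "Poly_Mapping.lookup (gga_scale c x) g = c *s Poly_Mapping.lookup x g"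
  by (simp add: gga_scale_def Poly_Mapping.map.rep_eq when_def)

global_interpretation gga: vector_space gga_scale
  by unfold_locales
     (auto intro!: poly_mapping_eqI
       simp: lookup_gga_scale lookup_add vec.scale_right_distrib vec.scale_left_distrib)


section \<open>The three twists\<close>

definition std_form :: "'a::field^'n \<Rightarrow> 'a^'n \<Rightarrow> 'a" where
  "std_form r s = (\<Sum>k\<in>UNIV. r $ k * s $ k)"

definition gelem :: "nat \<Rightarrow> bit^3" where
  "gelem i =
     [vector [0,0,0], vector [1,0,0], vector [0,1,0], vector [0,0,1],
      vector [1,1,0], vector [0,1,1], vector [1,1,1], vector [1,0,1]] ! i"

definition gindex :: "bit^3 \<Rightarrow> nat" where
  "gindex = the_inv_into {0..7} gelem"

text \<open>Addition of indices in \<open>{1..7}\<close>, modulo 7, with 7 representing the residue 0.\<close>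

definition iadd :: "nat \<Rightarrow> nat \<Rightarrow> nat" (infixl "\<oplus>\<^sub>7" 65) where
  "i \<oplus>\<^sub>7 k = (if (i + k) mod 7 = 0 then 7 else (i + k) mod 7)"

text \<open>
  The twist on \<open>Z\<^sub>2\<^sup>3\<close> determined by \<open>\<sigma>(i, i+1) = p1\<close>, \<open>\<sigma>(i, i+2) = p2\<close> and \<open>\<sigma>(i, i+4) = p4\<close>
  for all nonzero indices \<open>i\<close>.
\<close>

definition twist_of ::
  "('v \<Rightarrow> 'v \<Rightarrow> 'v) \<Rightarrow> ('v \<Rightarrow> 'v \<Rightarrow> 'v) \<Rightarrow> ('v \<Rightarrow> 'v \<Rightarrow> 'v) \<Rightarrow>
   bit^3 \<Rightarrow> bit^3 \<Rightarrow> 'v \<Rightarrow> 'v \<Rightarrow> 'v::ab_group_add" where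
  "twist_of p1 p2 p4 g h r s =
     (let i = gindex g; j = gindex h in
      if i = 0 \<or> j = 0 \<or> i = j then 0
      else if j = i \<oplus>\<^sub>7 1 then p1 r s
      else if j = i \<oplus>\<^sub>7 2 then p2 r s
      else if j = i \<oplus>\<^sub>7 4 then p4 r s
      else if j = i \<oplus>\<^sub>7 3 then - p4 s r
      else if j = i \<oplus>\<^sub>7 5 then - p2 s r
      else - p1 s r)"

definition twist_V :: "bit^3 \<Rightarrow> bit^3 \<Rightarrow> 'a::field^4 \<Rightarrow> 'a^4 \<Rightarrow> 'a^4" where
  "twist_V = twist_of
     (\<lambda>a b. vector [- a$2 * b$1 - a$3 * b$3, - a$2 * b$3 - a$3 * b$1,
                    a$1 * b$2 + a$4 * b$4, a$1 * b$4 + a$4 * b$2])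
     (\<lambda>a b. vector [a$2 * b$3 + a$4 * b$4, - a$1 * b$1 - a$3 * b$2,
                    - a$1 * b$2 - a$3 * b$1, a$2 * b$4 + a$4 * b$3])
     (\<lambda>a b. vector [- a$1 * b$2 - a$2 * b$3, a$3 * b$1 + a$4 * b$4,
                    - a$1 * b$3 - a$2 * b$2, a$3 * b$4 + a$4 * b$1])"

text \<open>The twist on \<open>S\<close> is the restriction of this one.\<close>

definition twist_W :: "bit^3 \<Rightarrow> bit^3 \<Rightarrow> 'a::field^3 \<Rightarrow> 'a^3 \<Rightarrow> 'a^3" where
  "twist_W = twist_of
     (\<lambda>a b. vector [- a$2 * b$1 - a$3 * b$3, - a$2 * b$3 - a$3 * b$1, a$1 * b$2])
     (\<lambda>a b. vector [a$2 * b$3, - a$1 * b$1 - a$3 * b$2, - a$1 * b$2 - a$3 * b$1])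
     (\<lambda>a b. vector [- a$1 * b$2 - a$2 * b$3, a$3 * b$1, - a$1 * b$3 - a$2 * b$2])"

definition space_S :: "('a::field^3) set" where
  "space_S = {a. a$1 + a$2 + a$3 = 0}"


section \<open>The three Killing forms\<close>

definition killing_V :: "(bit^3 \<Rightarrow>\<^sub>0 'a::field^4) \<Rightarrow> (bit^3 \<Rightarrow>\<^sub>0 'a^4) \<Rightarrow> 'a" where
  "killing_V = killing_form gga_scale (gga_space UNIV) (gga_bracket twist_V)"

definition killing_W :: "(bit^3 \<Rightarrow>\<^sub>0 'a::field^3) \<Rightarrow> (bit^3 \<Rightarrow>\<^sub>0 'a^3) \<Rightarrow> 'a" where
  "killing_W = killing_form gga_scale (gga_space UNIV) (gga_bracket twist_W)"

definition killing_S :: "(bit^3 \<Rightarrow>\<^sub>0 'a::field^3) \<Rightarrow> (bit^3 \<Rightarrow>\<^sub>0 'a^3) \<Rightarrow> 'a" where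
  "killing_S = killing_form gga_scale (gga_space space_S) (gga_bracket twist_W)"

text \<open>The homogeneous component of degree \<open>g\<close>.\<close>

definition gga_component :: "'v set \<Rightarrow> 'g \<Rightarrow> ('g \<Rightarrow>\<^sub>0 'v::zero) set" where
  "gga_component U g = Poly_Mapping.single g ` U"

text \<open>
  In characteristic 5 the coefficient \<open>- 10\<close> of \<open>killing_W\<close> vanishes, so that \<open>killing_W\<close> is the
  zero form and its radical is the whole algebra. The neutral component can therefore be its
  radical only in characteristic different from 5.
\<close>

end

theory Submission
  imports Defs
begin

text \<open>
  The trace of an endomorphism is computed from a basis \<open>e j\<close> and its dual basis \<open>\<phi> j\<close> as the sum
  of \<open>\<phi> j (f (e j))\<close>. In a generalized group algebra \<open>ad x \<circ> ad y\<close> shifts degrees by the sum of the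
  degrees of \<open>x\<close> and \<open>y\<close>, so over \<open>Z\<^sub>2\<^sup>3\<close> only pairs of components of equal degree contribute to the
  Killing form. Since \<open>g\<^sub>i + g\<^sub>i\<^sub>+\<^sub>1 = g\<^sub>i\<^sub>+\<^sub>3\<close>, \<open>g\<^sub>i + g\<^sub>i\<^sub>+\<^sub>2 = g\<^sub>i\<^sub>+\<^sub>6\<close> and \<open>g\<^sub>i + g\<^sub>i\<^sub>+\<^sub>4 = g\<^sub>i\<^sub>+\<^sub>5\<close>, the
  contribution of a degree \<open>g\<^sub>i\<close> with \<open>i \<noteq> 0\<close> is a sum of six traces that does not depend on \<open>i\<close>; it
  is a multiple of the standard form, while degree \<open>0\<close> contributes nothing. The radical then follows
  from the nondegeneracy of the standard form; on \<open>S\<close> this uses that \<open>3 \<noteq> 0\<close>.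
\<close>

section \<open>Traces computed from dual families\<close>

text \<open>Duality makes the \<open>e j\<close> independent and \<open>expand\<close> makes them
  span \<open>U\<close>, so they form a basis whose coordinate functionals on \<open>U\<close> are
  the \<open>\<phi> j\<close>. The basis chosen inside \<open>trace_on\<close> can thus be replaced
  by an explicit indexed one.\<close>

lemma (in vector_space) trace_on_dual:
  assumes J: "finite J" and U: "subspace U" and e: "\<And>j. j \<in> J \<Longrightarrow> e j \<in> U"
    and lin: "\<And>j. j \<in> J \<Longrightarrow> Vector_Spaces.linear scale (*) (\<phi> j)"
    and dual: "\<And>i j. i \<in> J \<Longrightarrow> j \<in> J \<Longrightarrow> \<phi> i (e j) = (if i = j then 1 else 0)"
    and expand: "\<And>v. v \<in> U \<Longrightarrow> v = (\<Sum>j\<in>J. scale (\<phi> j v) (e j))"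
    and f: "Vector_Spaces.linear scale scale f" "f ` U \<subseteq> U"
  shows "trace_on scale U f = (\<Sum>j\<in>J. \<phi> j (f (e j)))"
proof -
  have inj: "inj_on e J"
    using dual by (intro inj_onI) (metis zero_neq_one)
  have ind: "independent (e ` J)"
  proof
    assume "dependent (e ` J)"
    then obtain u i where i: "i \<in> J" "u (e i) \<noteq> 0"
      and z: "(\<Sum>v\<in>e ` J. scale (u v) v) = 0"
      using J by (auto simp: dependent_finite)
    interpret l: Vector_Spaces.linear scale "(*)" "\<phi> i" by (rule lin[OF i(1)])
    \<comment> \<open>Applying \<open>\<phi> i\<close> to the vanishing combination isolates its
      coefficient at \<open>e i\<close>, which is nonzero.\<close>
    have "0 = \<phi> i (\<Sum>j\<in>J. scale (u (e j)) (e j))"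
      using z by (simp add: sum.reindex[OF inj])
    also have "\<dots> = (\<Sum>j\<in>J. u (e j) * \<phi> i (e j))"
      by (simp add: l.sum l.scale)
    also have "\<dots> = (\<Sum>j\<in>J. if i = j then u (e j) else 0)"
      by (rule sum.cong) (use i(1) dual in auto)
    also have "\<dots> = u (e i)"
      using J i(1) by simp
    finally show False using i(2) by simp
  qed
  have span: "span (e ` J) = U"
  proof
    show "span (e ` J) \<subseteq> U"
      using e U by (intro span_minimal) auto
    show "U \<subseteq> span (e ` J)"
    proof
      fix v assume "v \<in> U"
      then have "v = (\<Sum>j\<in>J. scale (\<phi> j v) (e j))"
        by (rule expand)
      also have "\<dots> \<in> span (e ` J)"
        by (intro span_sum span_scale span_base imageI)
      finally show "v \<in> span (e ` J)" .
    qed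
  qed
  have rep: "representation (e ` J) v (e i) = \<phi> i v" if v: "v \<in> U" and i: "i \<in> J" for v i
  proof -
    have "representation (e ` J) v (e i) =
        representation (e ` J) (\<Sum>j\<in>J. scale (\<phi> j v) (e j)) (e i)"
      using expand[OF v] by simp
    also have "\<dots> = (\<Sum>j\<in>J. \<phi> j v * representation (e ` J) (e j) (e i))"
      using ind by (simp add: representation_sum representation_scale span_scale span_base)
    also have "\<dots> = (\<Sum>j\<in>J. if j = i then \<phi> j v else 0)"
      by (rule sum.cong) (use ind i inj in \<open>auto simp: representation_basis inj_on_eq_iff\<close>)
    also have "\<dots> = \<phi> i v"
      using J i by simp
    finally show ?thesis .
  qed
  have "trace_on scale U f = (\<Sum>b\<in>e ` J. representation (e ` J) (f b) b)"
    using trace_on_eq[OF ind span] J f by simp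
  also have "\<dots> = (\<Sum>j\<in>J. \<phi> j (f (e j)))"
    using e f(2) by (auto simp: sum.reindex[OF inj] intro!: sum.cong rep)
  finally show ?thesis .
qed

section \<open>The Killing form of a generalized group algebra\<close>

lemma gga_subspace: "vec.subspace U \<Longrightarrow> gga.subspace (gga_space U)"
  by (auto simp: gga.subspace_def vec.subspace_def gga_space_def lookup_add lookup_gga_scale)

text \<open>The index sets in \<open>gga_bracket\<close> are supports, which vary with the
  arguments. As \<open>\<sigma>\<close> vanishes when either argument is 0, the sums may run over
  the whole finite group, and linearity can then be checked term by term.\<close>

lemma gga_bracket_eq_sum:
  assumes fin: "finite (UNIV :: 'g::ab_group_add set)"
    and l: "\<And>g h s. \<sigma> g h 0 s = 0" and r: "\<And>g h r. \<sigma> g h r 0 = 0"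
  shows "gga_bracket \<sigma> (x :: 'g \<Rightarrow>\<^sub>0 'v::ab_group_add) y =
    (\<Sum>g\<in>UNIV. \<Sum>h\<in>UNIV.
      Poly_Mapping.single (g + h) (\<sigma> g h (Poly_Mapping.lookup x g) (Poly_Mapping.lookup y h)))"
proof -
  have "gga_bracket \<sigma> x y =
    (\<Sum>g\<in>Poly_Mapping.keys x. \<Sum>h\<in>UNIV.
      Poly_Mapping.single (g + h) (\<sigma> g h (Poly_Mapping.lookup x g) (Poly_Mapping.lookup y h)))"
    unfolding gga_bracket_def
    by (intro sum.cong refl sum.mono_neutral_left) (auto simp: fin r in_keys_iff)
  also have "\<dots> = (\<Sum>g\<in>UNIV. \<Sum>h\<in>UNIV.
      Poly_Mapping.single (g + h) (\<sigma> g h (Poly_Mapping.lookup x g) (Poly_Mapping.lookup y h)))"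
    by (intro sum.mono_neutral_left) (auto simp: fin l in_keys_iff)
  finally show ?thesis .
qed

lemma lookup_gga_bracket:
  assumes fin: "finite (UNIV :: 'g::ab_group_add set)"
    and l: "\<And>g h s. \<sigma> g h 0 s = 0" and r: "\<And>g h r. \<sigma> g h r 0 = 0"
  shows "Poly_Mapping.lookup (gga_bracket \<sigma> (x :: 'g \<Rightarrow>\<^sub>0 'v::ab_group_add) y) k =
    (\<Sum>g\<in>UNIV. \<sigma> g (k - g) (Poly_Mapping.lookup x g) (Poly_Mapping.lookup y (k - g)))"
proof -
  have eq: "g + h = k \<longleftrightarrow> h = k - g" for g h :: 'g
    by (auto simp: algebra_simps)
  show ?thesis
    by (simp add: gga_bracket_eq_sum[of \<sigma>, OF fin l r] lookup_sum lookup_single when_def eq fin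
        cong: if_cong)
qed

text \<open>A diagonal entry at degree \<open>k\<close> arises only when the two brackets return to
  \<open>k\<close>: the component of \<open>y\<close> of degree \<open>- g\<close> leads from
  \<open>k\<close> to \<open>k - g\<close>, and the component of \<open>x\<close> of degree
  \<open>g\<close> leads back.\<close>

lemma killing_form_dual:
  fixes \<sigma> :: "'g::ab_group_add \<Rightarrow> 'g \<Rightarrow> 'a::field^'n \<Rightarrow> 'a^'n \<Rightarrow> 'a^'n"
  assumes fin: "finite (UNIV :: 'g set)"
    and l: "\<And>g h s. \<sigma> g h 0 s = 0"
    and r: "\<And>g h r. Vector_Spaces.linear (*s) (*s) (\<sigma> g h r)"
    and U: "vec.subspace U"
    and \<sigma>U: "\<And>g h r s. r \<in> U \<Longrightarrow> s \<in> U \<Longrightarrow> \<sigma> g h r s \<in> U"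
    and J: "finite J" and e: "\<And>j. j \<in> J \<Longrightarrow> e j \<in> U"
    and lin: "\<And>j. j \<in> J \<Longrightarrow> Vector_Spaces.linear (*s) (*) (\<phi> j)"
    and dual: "\<And>i j. i \<in> J \<Longrightarrow> j \<in> J \<Longrightarrow> \<phi> i (e j) = (if i = j then 1 else 0)"
    and expand: "\<And>v. v \<in> U \<Longrightarrow> v = (\<Sum>j\<in>J. \<phi> j v *s e j)"
    and x: "x \<in> gga_space U" and y: "y \<in> gga_space U"
  shows "killing_form gga_scale (gga_space U) (gga_bracket \<sigma>) x y =
    (\<Sum>g\<in>UNIV. \<Sum>k\<in>UNIV. \<Sum>j\<in>J.
      \<phi> j (\<sigma> g (k - g) (Poly_Mapping.lookup x g) (\<sigma> (- g) k (Poly_Mapping.lookup y (- g)) (e j))))"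
proof -
  interpret s: Vector_Spaces.linear "(*s)" "(*s)" "\<sigma> g h r" for g h r by (rule r)
  note lb = lookup_gga_bracket[of \<sigma>, OF fin l s.zero]
  have br_lin: "Vector_Spaces.linear gga_scale gga_scale (gga_bracket \<sigma> z)" for z
    by unfold_locales
      (auto intro!: poly_mapping_eqI simp: lb lookup_add lookup_gga_scale s.add s.scale
        sum.distrib vec.scale_sum_right)
  have br_U: "gga_bracket \<sigma> z w \<in> gga_space U" if "z \<in> gga_space U" "w \<in> gga_space U" for z w
    using that U by (auto simp: gga_space_def lb intro!: vec.subspace_sum \<sigma>U)
  have lin': "Vector_Spaces.linear gga_scale (*) (\<lambda>v. \<phi> j (Poly_Mapping.lookup v g))"
    if "j \<in> J" for j and g :: 'g
  proof -
    interpret p: Vector_Spaces.linear "(*s)" "(*)" "\<phi> j" by (rule lin[OF that])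
    show ?thesis
      by unfold_locales (simp_all add: lookup_add lookup_gga_scale p.add p.scale)
  qed
  have zero: "\<phi> j 0 = 0" if "j \<in> J" for j
  proof -
    interpret p: Vector_Spaces.linear "(*s)" "(*)" "\<phi> j" by (rule lin[OF that])
    show ?thesis by simp
  qed
  have "killing_form gga_scale (gga_space U) (gga_bracket \<sigma>) x y =
      (\<Sum>(k, j)\<in>UNIV \<times> J. \<phi> j (Poly_Mapping.lookup
        ((gga_bracket \<sigma> x \<circ> gga_bracket \<sigma> y) (Poly_Mapping.single k (e j))) k))"
    unfolding killing_form_def
  \<comment> \<open>The basis consists of the monomials \<open>single k (e j)\<close>; the dual
    functional at \<open>(k, j)\<close> reads off the \<open>j\<close>-th coordinate of the
    coefficient at \<open>k\<close>.\<close>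
  proof (subst gga.trace_on_dual[where J = "UNIV \<times> J" and
        e = "\<lambda>(k, j). Poly_Mapping.single k (e j)" and
        \<phi> = "\<lambda>(k, j) v. \<phi> j (Poly_Mapping.lookup v k)"], goal_cases)
    case 1 show ?case using fin J by simp
  next
    case 2 show ?case using U by (rule gga_subspace)
  next
    case (3 j) then show ?case
      using e vec.subspace_0[OF U] by (auto simp: gga_space_def lookup_single when_def)
  next
    case (4 j) then show ?case using lin' by auto
  next
    case (5 i j) then show ?case
      by (cases "fst i = fst j") (auto simp: lookup_single when_def zero dual split: if_splits)
  next
    case (6 v)
    show ?case
    proof (rule poly_mapping_eqI)
      fix k
      have "Poly_Mapping.lookup v k = (\<Sum>j\<in>J. \<phi> j (Poly_Mapping.lookup v k) *s e j)"
        using 6 by (intro expand) (simp add: gga_space_def)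
      \<comment> \<open>A Kronecker factor brings the expansion at \<open>k\<close> into the shape
        of a double sum over degrees and basis indices.\<close>
      also have "\<dots> = (\<Sum>h\<in>UNIV. if h = k then (\<Sum>j\<in>J. \<phi> j (Poly_Mapping.lookup v h) *s e j) else 0)"
        using fin by simp
      also have "\<dots> = (\<Sum>h\<in>UNIV. \<Sum>j\<in>J. \<phi> j (Poly_Mapping.lookup v h) *s (if h = k then e j else 0))"
        by (intro sum.cong) auto
      finally show "Poly_Mapping.lookup v k =
        Poly_Mapping.lookup (\<Sum>j\<in>UNIV \<times> J. gga_scale
          ((case j of (k, j) \<Rightarrow> \<lambda>v. \<phi> j (Poly_Mapping.lookup v k)) v)
          (case j of (k, j) \<Rightarrow> Poly_Mapping.single k (e j))) k"
        by (simp add: lookup_sum lookup_gga_scale lookup_single when_def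
            sum.cartesian_product split_def)
    qed
  next
    case 7
    show ?case by (rule Vector_Spaces.linear_compose[OF br_lin br_lin])
  next
    case 8
    show ?case using x y br_U by auto
  next
    case 9
    show ?case by (simp add: split_def)
  qed
  also have "\<dots> = (\<Sum>k\<in>UNIV. \<Sum>j\<in>J. \<Sum>g\<in>UNIV.
      \<phi> j (\<sigma> g (k - g) (Poly_Mapping.lookup x g) (\<sigma> (- g) k (Poly_Mapping.lookup y (- g)) (e j))))"
    unfolding sum.cartesian_product[symmetric]
  proof (intro sum.cong refl)
    fix k j assume j: "j \<in> J"
    interpret p: Vector_Spaces.linear "(*s)" "(*)" "\<phi> j" by (rule lin[OF j])
    have *: "k = g - h \<longleftrightarrow> h = g - k" for g h :: 'g
      by (auto simp: algebra_simps)
    \<comment> \<open>From a monomial of degree \<open>k\<close>, degree \<open>h\<close> is reached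
      only through the component of \<open>y\<close> of degree \<open>h - k\<close>.\<close>
    have "Poly_Mapping.lookup (gga_bracket \<sigma> y (Poly_Mapping.single k (e j))) h =
        \<sigma> (h - k) k (Poly_Mapping.lookup y (h - k)) (e j)" for h
    proof -
      have "Poly_Mapping.lookup (gga_bracket \<sigma> y (Poly_Mapping.single k (e j))) h =
        (\<Sum>g\<in>UNIV. if g = h - k then \<sigma> (h - k) k (Poly_Mapping.lookup y (h - k)) (e j) else 0)"
        unfolding lb by (intro sum.cong refl) (auto simp: lookup_single when_def * s.zero)
      then show ?thesis using fin by simp
    qed
    then show "\<phi> j (Poly_Mapping.lookup
        ((gga_bracket \<sigma> x \<circ> gga_bracket \<sigma> y) (Poly_Mapping.single k (e j))) k) =
      (\<Sum>g\<in>UNIV. \<phi> j (\<sigma> g (k - g) (Poly_Mapping.lookup x g)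
        (\<sigma> (- g) k (Poly_Mapping.lookup y (- g)) (e j))))"
      by (simp add: lb p.sum)
  qed
  also have "\<dots> = (\<Sum>g\<in>UNIV. \<Sum>k\<in>UNIV. \<Sum>j\<in>J.
      \<phi> j (\<sigma> g (k - g) (Poly_Mapping.lookup x g) (\<sigma> (- g) k (Poly_Mapping.lookup y (- g)) (e j))))"
    by (subst (2) sum.swap) (intro sum.cong refl sum.swap)
  finally show ?thesis .
qed

section \<open>Indices and addition in \<open>Z_2^3\<close>\<close>

lemma index_cases:
  assumes "i \<in> {1..7::nat}"
  obtains "i = 1" | "i = 2" | "i = 3" | "i = 4" | "i = 5" | "i = 6" | "i = 7"
proof -
  have "{1..7::nat} = {1,2,3,4,5,6,7}" by auto
  with assms that show thesis by blast
qed

lemma bit3_eq_gelem: "\<exists>i\<in>{0..7}. (g :: bit^3) = gelem i"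
proof -
  have "{0..7::nat} = {0,1,2,3,4,5,6,7}" by auto
  then show ?thesis
    by (cases "g $ 1"; cases "g $ 2"; cases "g $ 3")
      (simp_all add: gelem_def vec_eq_iff forall_3)
qed

lemma inj_on_gelem: "inj_on gelem {0..7}"
proof -
  have "{0..7::nat} = {0,1,2,3,4,5,6,7}" by auto
  then show ?thesis
    by (simp add: gelem_def vec_eq_iff forall_3)
qed

lemma bij_betw_gelem: "bij_betw gelem {0..7} UNIV"
  using inj_on_gelem bit3_eq_gelem by (auto simp: bij_betw_def)

lemma gindex_gelem: "i \<in> {0..7} \<Longrightarrow> gindex (gelem i) = i"
  unfolding gindex_def by (rule the_inv_into_f_f[OF inj_on_gelem])

lemma finite_bit3: "finite (UNIV :: (bit^3) set)"
  using bij_betw_finite[OF bij_betw_gelem] by simp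

lemma bit3_uminus: "- g = (g :: bit^3)"
  by (simp add: vec_eq_iff)

lemma bit3_diff: "g - h = g + (h :: bit^3)"
  by (simp add: vec_eq_iff)

lemma gelem_numeral:
  "gelem 1 = vector [1,0,0]" "gelem 2 = vector [0,1,0]" "gelem 3 = vector [0,0,1]"
  "gelem 4 = vector [1,1,0]" "gelem 5 = vector [0,1,1]" "gelem 6 = vector [1,1,1]"
  "gelem 7 = vector [1,0,1]"
  by (simp_all add: gelem_def)

lemma gelem_add_table:
  "gelem 2 + gelem 1 = gelem 4" "gelem 3 + gelem 1 = gelem 7" "gelem 4 + gelem 1 = gelem 2"
  "gelem 5 + gelem 1 = gelem 6" "gelem 6 + gelem 1 = gelem 5" "gelem 7 + gelem 1 = gelem 3"
  "gelem 3 + gelem 2 = gelem 5" "gelem 4 + gelem 2 = gelem 1" "gelem 5 + gelem 2 = gelem 3"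
  "gelem 6 + gelem 2 = gelem 7" "gelem 7 + gelem 2 = gelem 6" "gelem 1 + gelem 2 = gelem 4"
  "gelem 4 + gelem 3 = gelem 6" "gelem 5 + gelem 3 = gelem 2" "gelem 6 + gelem 3 = gelem 4"
  "gelem 7 + gelem 3 = gelem 1" "gelem 1 + gelem 3 = gelem 7" "gelem 2 + gelem 3 = gelem 5"
  "gelem 5 + gelem 4 = gelem 7" "gelem 6 + gelem 4 = gelem 3" "gelem 7 + gelem 4 = gelem 5"
  "gelem 1 + gelem 4 = gelem 2" "gelem 2 + gelem 4 = gelem 1" "gelem 3 + gelem 4 = gelem 6"
  "gelem 6 + gelem 5 = gelem 1" "gelem 7 + gelem 5 = gelem 4" "gelem 1 + gelem 5 = gelem 6"
  "gelem 2 + gelem 5 = gelem 3" "gelem 3 + gelem 5 = gelem 2" "gelem 4 + gelem 5 = gelem 7"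
  "gelem 7 + gelem 6 = gelem 2" "gelem 1 + gelem 6 = gelem 5" "gelem 2 + gelem 6 = gelem 7"
  "gelem 3 + gelem 6 = gelem 4" "gelem 4 + gelem 6 = gelem 3" "gelem 5 + gelem 6 = gelem 1"
  "gelem 1 + gelem 7 = gelem 3" "gelem 2 + gelem 7 = gelem 6" "gelem 3 + gelem 7 = gelem 1"
  "gelem 4 + gelem 7 = gelem 5" "gelem 5 + gelem 7 = gelem 4" "gelem 6 + gelem 7 = gelem 2"
  by (simp_all add: gelem_numeral vec_eq_iff forall_3 del: One_nat_def)

text \<open>The nonzero elements are the points of the Fano plane, and its lines are the cyclic
  shifts of \<open>{1, 2, 4}\<close>. The lines through \<open>i\<close> are
  \<open>{i, i+1, i+3}\<close>, \<open>{i, i+2, i+6}\<close> and \<open>{i, i+4, i+5}\<close>;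
  adding \<open>gelem i\<close> exchanges the other two points on each of them.\<close>

lemma gelem_add:
  assumes "i \<in> {1..7}"
  shows "gelem (i \<oplus>\<^sub>7 1) + gelem i = gelem (i \<oplus>\<^sub>7 3)"
    and "gelem (i \<oplus>\<^sub>7 3) + gelem i = gelem (i \<oplus>\<^sub>7 1)"
    and "gelem (i \<oplus>\<^sub>7 2) + gelem i = gelem (i \<oplus>\<^sub>7 6)"
    and "gelem (i \<oplus>\<^sub>7 6) + gelem i = gelem (i \<oplus>\<^sub>7 2)"
    and "gelem (i \<oplus>\<^sub>7 4) + gelem i = gelem (i \<oplus>\<^sub>7 5)"
    and "gelem (i \<oplus>\<^sub>7 5) + gelem i = gelem (i \<oplus>\<^sub>7 4)"
  by (rule index_cases[OF assms]; simp add: iadd_def gelem_add_table flip: One_nat_def)+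

lemma gelem_0: "gelem 0 = 0"
  by (simp add: gelem_def vec_eq_iff forall_3)

text \<open>The nonzero degrees other than \<open>gelem i\<close> are listed by their shift from
  \<open>i\<close>, the form in which \<open>twist_of\<close> is given, so that sums of twists come
  out independent of \<open>i\<close>.\<close>

lemma sum_bit3:
  fixes F :: "bit^3 \<Rightarrow> 'a::comm_monoid_add"
  assumes "i \<in> {1..7}"
  shows "sum F UNIV = F 0 + F (gelem i) +
    (\<Sum>m\<in>{1,2,3,4,5,6}. F (gelem (i \<oplus>\<^sub>7 m)))"
proof -
  have s: "{0..7::nat} = {0,1,2,3,4,5,6,7}" by auto
  have "sum F UNIV = (\<Sum>j\<in>{0..7}. F (gelem j))"
    by (rule sum.reindex_bij_betw[OF bij_betw_gelem, symmetric])
  also have "\<dots> = F 0 + F (gelem i) + (\<Sum>m\<in>{1,2,3,4,5,6}. F (gelem (i \<oplus>\<^sub>7 m)))"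
    by (rule index_cases[OF assms]; simp add: s iadd_def gelem_0 add_ac flip: One_nat_def)
  finally show ?thesis .
qed

section \<open>The Killing form of a cyclic twist\<close>

lemma twist_of_0:
  "twist_of p1 p2 p4 0 h r s = 0" "twist_of p1 p2 p4 g 0 r s = 0" "twist_of p1 p2 p4 g g r s = 0"
  using gindex_gelem[of 0] by (simp_all add: twist_of_def gelem_0)

lemma twist_of_gelem:
  assumes "i \<in> {1..7}"
  shows "twist_of p1 p2 p4 (gelem i) (gelem (i \<oplus>\<^sub>7 1)) r s = p1 r s"
    and "twist_of p1 p2 p4 (gelem i) (gelem (i \<oplus>\<^sub>7 2)) r s = p2 r s"
    and "twist_of p1 p2 p4 (gelem i) (gelem (i \<oplus>\<^sub>7 4)) r s = p4 r s"
    and "twist_of p1 p2 p4 (gelem i) (gelem (i \<oplus>\<^sub>7 3)) r s = - p4 s r"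
    and "twist_of p1 p2 p4 (gelem i) (gelem (i \<oplus>\<^sub>7 5)) r s = - p2 s r"
    and "twist_of p1 p2 p4 (gelem i) (gelem (i \<oplus>\<^sub>7 6)) r s = - p1 s r"
proof -
  \<comment> \<open>\<open>gindex\<close> inverts \<open>gelem\<close> on \<open>{0..7}\<close>, and
    \<open>\<oplus>\<^sub>7\<close> always yields an index in \<open>{1..7}\<close>.\<close>
  have *: "gindex (gelem (i \<oplus>\<^sub>7 m)) = i \<oplus>\<^sub>7 m" "gindex (gelem i) = i" for m
    using assms by (auto intro!: gindex_gelem simp: iadd_def)
  show "twist_of p1 p2 p4 (gelem i) (gelem (i \<oplus>\<^sub>7 1)) r s = p1 r s"
    and "twist_of p1 p2 p4 (gelem i) (gelem (i \<oplus>\<^sub>7 2)) r s = p2 r s"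
    and "twist_of p1 p2 p4 (gelem i) (gelem (i \<oplus>\<^sub>7 4)) r s = p4 r s"
    and "twist_of p1 p2 p4 (gelem i) (gelem (i \<oplus>\<^sub>7 3)) r s = - p4 s r"
    and "twist_of p1 p2 p4 (gelem i) (gelem (i \<oplus>\<^sub>7 5)) r s = - p2 s r"
    and "twist_of p1 p2 p4 (gelem i) (gelem (i \<oplus>\<^sub>7 6)) r s = - p1 s r"
    unfolding twist_of_def Let_def *
    by (rule index_cases[OF assms]; simp add: iadd_def flip: One_nat_def)+
qed

text \<open>The degrees \<open>k = 0\<close> and \<open>k = gelem i\<close> drop out because the
  inner twist is 0 there. On each of the three Fano lines through \<open>i\<close> the outer twist
  sees the point other than \<open>k\<close>, so shifts 1 and 3, 2 and 6, 4 and 5 are paired; the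
  right-hand side lists the pairs in this order.\<close>

lemma sum_twist_of:
  fixes \<phi> :: "'v::ab_group_add \<Rightarrow> 'a::comm_monoid_add"
  assumes i: "i \<in> {1..7}" and p: "\<And>r. p1 r 0 = 0" "\<And>r. p2 r 0 = 0" "\<And>r. p4 r 0 = 0"
    "\<And>r. p1 0 r = 0" "\<And>r. p2 0 r = 0" "\<And>r. p4 0 r = 0"
    and \<phi>: "\<phi> 0 = 0"
  shows "(\<Sum>k\<in>UNIV. \<phi> (twist_of p1 p2 p4 (gelem i) (k + gelem i) r
        (twist_of p1 p2 p4 (gelem i) k s e))) =
     \<phi> (- p4 (p1 s e) r) + \<phi> (p1 r (- p4 e s)) + \<phi> (- p1 (p2 s e) r) + \<phi> (p2 r (- p1 e s)) +
     \<phi> (- p2 (p4 s e) r) + \<phi> (p4 r (- p2 e s))"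
proof -
  have "twist_of p1 p2 p4 (gelem i) g r 0 = 0" for g
    by (simp add: twist_of_def Let_def p)
  then show ?thesis
    by (simp add: sum_bit3[OF i] gelem_add[OF i] twist_of_gelem[OF i] twist_of_0 \<phi>
        flip: One_nat_def) (simp only: add_ac)
qed
lemma linear_map_0: "Vector_Spaces.linear s1 s2 f \<Longrightarrow> f 0 = 0"
  by (simp add: linear_iff_module_hom module_hom.zero)

definition vec_bilinear :: "('a::field^'n \<Rightarrow> 'a^'n \<Rightarrow> 'a^'n) \<Rightarrow> bool" where
  "vec_bilinear p \<longleftrightarrow> (\<forall>r. Vector_Spaces.linear (*s) (*s) (p r)) \<and>
     (\<forall>s. Vector_Spaces.linear (*s) (*s) (\<lambda>r. p r s))"

lemma vec_bilinearI:
  assumes "\<And>r s t. p r (s + t) = p r s + p r t" "\<And>r s t. p (s + t) r = p s r + p t r"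
    and "\<And>c r s. p r (c *s s) = c *s p r s" "\<And>c r s. p (c *s s) r = c *s p s r"
  shows "vec_bilinear p"
  using assms by (simp add: vec_bilinear_def Vector_Spaces.linear_iff vec.vector_space_axioms)

lemma vec_bilinear_map_0:
  assumes "vec_bilinear p"
  shows "p r 0 = 0" "p 0 r = 0"
  using assms linear_map_0[of "(*s)" "(*s)" "p r"] linear_map_0[of "(*s)" "(*s)" "\<lambda>s. p s r"]
  by (simp_all add: vec_bilinear_def)

text \<open>This collects what the three algebras share. Since \<open>- g = g\<close>, coefficients
  of \<open>x\<close> and \<open>y\<close> are paired in equal degrees; degree 0 gives nothing, and
  every other degree gives the same six-term trace. For each algebra only the coordinate identity
  \<open>trace\<close> on the coefficient space is left.\<close>

lemma killing_form_twist_of: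
  fixes p1 p2 p4 :: "'a::field^'n \<Rightarrow> 'a^'n \<Rightarrow> 'a^'n"
  assumes p: "vec_bilinear p1" "vec_bilinear p2" "vec_bilinear p4"
    and U: "vec.subspace U"
    and pU: "\<And>r s. r \<in> U \<Longrightarrow> s \<in> U \<Longrightarrow> p1 r s \<in> U \<and> p2 r s \<in> U \<and> p4 r s \<in> U"
    and J: "finite J" and e: "\<And>j. j \<in> J \<Longrightarrow> e j \<in> U"
    and lin: "\<And>j. j \<in> J \<Longrightarrow> Vector_Spaces.linear (*s) (*) (\<phi> j)"
    and dual: "\<And>i j. i \<in> J \<Longrightarrow> j \<in> J \<Longrightarrow> \<phi> i (e j) = (if i = j then 1 else 0)"
    and expand: "\<And>v. v \<in> U \<Longrightarrow> v = (\<Sum>j\<in>J. \<phi> j v *s e j)"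
    and trace: "\<And>r s. r \<in> U \<Longrightarrow> s \<in> U \<Longrightarrow>
      (\<Sum>j\<in>J. \<phi> j (- p4 (p1 s (e j)) r) + \<phi> j (p1 r (- p4 (e j) s)) +
        \<phi> j (- p1 (p2 s (e j)) r) + \<phi> j (p2 r (- p1 (e j) s)) +
        \<phi> j (- p2 (p4 s (e j)) r) + \<phi> j (p4 r (- p2 (e j) s))) = c * std_form r s"
    and x: "x \<in> gga_space U" and y: "y \<in> gga_space U"
  shows "killing_form gga_scale (gga_space U) (gga_bracket (twist_of p1 p2 p4)) x y =
    c * (\<Sum>i\<in>{1..7}. std_form (Poly_Mapping.lookup x (gelem i)) (Poly_Mapping.lookup y (gelem i)))"
proof -
  note b = p[unfolded vec_bilinear_def]
  have zero: "p1 r 0 = 0" "p2 r 0 = 0" "p4 r 0 = 0" "p1 0 r = 0" "p2 0 r = 0" "p4 0 r = 0" for r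
    using p by (simp_all add: vec_bilinear_map_0)
  have l: "twist_of p1 p2 p4 g h 0 s = 0" for g h s
    by (simp add: twist_of_def Let_def zero)
  have r: "Vector_Spaces.linear (*s) (*s) (twist_of p1 p2 p4 g h r)" for g h r
  proof -
    \<comment> \<open>Shifts 3, 5 and 6 exchange the arguments of the products, so linearity of the
      twist in its second argument rests on linearity of the products in both.\<close>
    interpret p1: Vector_Spaces.linear "(*s)" "(*s)" "p1 r" using b by blast
    interpret p2: Vector_Spaces.linear "(*s)" "(*s)" "p2 r" using b by blast
    interpret p4: Vector_Spaces.linear "(*s)" "(*s)" "p4 r" using b by blast
    interpret q1: Vector_Spaces.linear "(*s)" "(*s)" "\<lambda>s. p1 s r" using b by blast
    interpret q2: Vector_Spaces.linear "(*s)" "(*s)" "\<lambda>s. p2 s r" using b by blast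
    interpret q4: Vector_Spaces.linear "(*s)" "(*s)" "\<lambda>s. p4 s r" using b by blast
    show ?thesis
      by unfold_locales
        (simp_all add: twist_of_def Let_def p1.add p2.add p4.add q1.add q2.add q4.add
          p1.scale p2.scale p4.scale q1.scale q2.scale q4.scale)
  qed
  have tU: "twist_of p1 p2 p4 g h r s \<in> U" if "r \<in> U" "s \<in> U" for g h r s
    using pU[OF that] pU[OF that(2,1)] U
    by (simp add: twist_of_def Let_def vec.subspace_0 vec.subspace_neg)
  \<comment> \<open>The contribution of degree \<open>g\<close>, with signs of degrees dropped
    because every element is its own negative.\<close>
  define T where "T g = (\<Sum>k\<in>UNIV. \<Sum>j\<in>J. \<phi> j (twist_of p1 p2 p4 g (k + g) (Poly_Mapping.lookup x g)
      (twist_of p1 p2 p4 g k (Poly_Mapping.lookup y g) (e j))))" for g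
  have \<phi>0: "\<phi> j 0 = 0" if "j \<in> J" for j
    using lin[OF that] by (rule linear_map_0)
  have "killing_form gga_scale (gga_space U) (gga_bracket (twist_of p1 p2 p4)) x y =
      (\<Sum>g\<in>UNIV. T g)"
    by (subst killing_form_dual[where \<sigma> = "twist_of p1 p2 p4" and e = e and \<phi> = \<phi>,
          OF finite_bit3 l r U tU J e lin dual expand x y])
      (simp_all add: T_def bit3_uminus bit3_diff)
  also have "\<dots> = (\<Sum>i\<in>{0..7}. T (gelem i))"
    by (rule sum.reindex_bij_betw[OF bij_betw_gelem, symmetric])
  also have "{0..7} = insert 0 {1..7::nat}"
    by auto
  also have "(\<Sum>i\<in>insert 0 {1..7}. T (gelem i)) = (\<Sum>i\<in>{1..7}. T (gelem i))"
    by (simp add: T_def gelem_0 twist_of_0 \<phi>0)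
  also have "\<dots> = (\<Sum>i\<in>{1..7}.
      c * std_form (Poly_Mapping.lookup x (gelem i)) (Poly_Mapping.lookup y (gelem i)))"
  proof (rule sum.cong)
    fix i :: nat assume i: "i \<in> {1..7}"
    show "T (gelem i) =
        c * std_form (Poly_Mapping.lookup x (gelem i)) (Poly_Mapping.lookup y (gelem i))"
      unfolding T_def
      \<comment> \<open>With the sum over \<open>j\<close> outermost, \<open>sum_twist_of\<close>
        applies to each \<open>\<phi> j\<close> separately.\<close>
      by (subst sum.swap, subst trace[symmetric])
        (use x y in \<open>auto simp: gga_space_def intro!: sum.cong sum_twist_of i zero \<phi>0\<close>)
  qed simp
  finally show ?thesis
    by (simp add: sum_distrib_left)
qed

section \<open>The radical of a multiple of the standard form\<close>

lemma std_form_0: "std_form 0 s = 0" "std_form r 0 = 0"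
  by (simp_all add: std_form_def)

context
  fixes U :: "('a::field^'n) set" and \<kappa> and c :: 'a
  assumes \<kappa>: "\<And>x y. x \<in> gga_space U \<Longrightarrow> y \<in> gga_space U \<Longrightarrow> \<kappa> x y =
      c * (\<Sum>i\<in>{1..7}. std_form (Poly_Mapping.lookup x (gelem i)) (Poly_Mapping.lookup y (gelem i)))"
    and U: "0 \<in> U"
begin

lemma single_in_gga_space: "r \<in> U \<Longrightarrow> Poly_Mapping.single g r \<in> gga_space U"
  using U by (simp add: gga_space_def lookup_single when_def)

lemma form_single:
  assumes i: "i \<in> {1..7}" and j: "j \<in> {1..7}" and r: "r \<in> U" and s: "s \<in> U"
  shows "\<kappa> (Poly_Mapping.single (gelem i) r) (Poly_Mapping.single (gelem j) s) =
    c * std_form r s * (if i = j then 1 else 0)"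
proof -
  have eq: "gelem k = gelem l \<longleftrightarrow> k = l" if "k \<in> {1..7}" "l \<in> {1..7}" for k l
    using that by (intro inj_on_eq_iff[OF inj_on_gelem]) auto
  have "(\<Sum>k\<in>{1..7}. std_form (Poly_Mapping.lookup (Poly_Mapping.single (gelem i) r) (gelem k))
        (Poly_Mapping.lookup (Poly_Mapping.single (gelem j) s) (gelem k))) =
      (\<Sum>k\<in>{1..7}. if k = i then std_form r (if i = j then s else 0) else 0)"
    by (rule sum.cong) (use i j in \<open>auto simp: lookup_single when_def eq std_form_0\<close>)
  also have "\<dots> = std_form r s * (if i = j then 1 else 0)"
    using i by (simp add: std_form_0)
  finally show ?thesis
    using r s by (simp add: \<kappa> single_in_gga_space)
qed

text \<open>The formula for \<open>\<kappa>\<close> does not involve the coefficient at degree 0.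
  The inclusion holds for every \<open>c\<close>, also for \<open>c = 0\<close>, which covers
  \<open>killing_W\<close> in characteristic 5.\<close>

lemma component_subset_radical: "gga_component U (gelem 0) \<subseteq> form_radical (gga_space U) \<kappa>"
proof -
  have "gelem 0 \<noteq> gelem i" if "i \<in> {1..7}" for i
    using that inj_on_eq_iff[OF inj_on_gelem, of 0 i] by auto
  then show ?thesis
    by (auto simp: gga_component_def form_radical_def \<kappa> single_in_gga_space lookup_single when_def
        std_form_0 intro!: sum.neutral)
qed

text \<open>Testing an element \<open>x\<close> of the radical against the monomials of degree
  \<open>gelem i\<close> gives \<open>c\<close> times the standard form with the coefficient of
  \<open>x\<close> there. Nondegeneracy on \<open>U\<close> kills this coefficient for each
  \<open>i\<close> in \<open>{1..7}\<close>, and only degree 0 remains.\<close>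

lemma component_eq_radical:
  assumes c: "c \<noteq> 0"
    and nondeg: "\<And>r. r \<in> U \<Longrightarrow> (\<And>s. s \<in> U \<Longrightarrow> std_form r s = 0) \<Longrightarrow> r = 0"
  shows "gga_component U (gelem 0) = form_radical (gga_space U) \<kappa>"
proof (rule equalityI[OF component_subset_radical subsetI])
  fix x assume x: "x \<in> form_radical (gga_space U) \<kappa>"
  have xU: "Poly_Mapping.lookup x g \<in> U" for g
    using x by (simp add: form_radical_def gga_space_def)
  have "Poly_Mapping.lookup x (gelem i) = 0" if i: "i \<in> {1..7}" for i
  proof (rule nondeg[OF xU])
    fix s assume s: "s \<in> U"
    have eq: "gelem i = gelem k \<longleftrightarrow> i = k" if "k \<in> {1..7}" for k
      using that i by (intro inj_on_eq_iff[OF inj_on_gelem]) auto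
    have "0 = \<kappa> x (Poly_Mapping.single (gelem i) s)"
      using x s by (simp add: form_radical_def single_in_gga_space)
    also have "\<dots> = c * (\<Sum>k\<in>{1..7}. std_form (Poly_Mapping.lookup x (gelem k))
        (Poly_Mapping.lookup (Poly_Mapping.single (gelem i) s) (gelem k)))"
      using x s by (intro \<kappa>) (simp_all add: form_radical_def single_in_gga_space)
    also have "(\<Sum>k\<in>{1..7}. std_form (Poly_Mapping.lookup x (gelem k))
        (Poly_Mapping.lookup (Poly_Mapping.single (gelem i) s) (gelem k))) =
      (\<Sum>k\<in>{1..7}. if k = i then std_form (Poly_Mapping.lookup x (gelem i)) s else 0)"
      by (rule sum.cong) (auto simp: lookup_single when_def eq std_form_0)
    finally show "std_form (Poly_Mapping.lookup x (gelem i)) s = 0"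
      using c i by simp
  qed
  then have "Poly_Mapping.lookup x g = 0" if "g \<noteq> gelem 0" for g
  proof -
    obtain i where i: "i \<in> {0..7}" "g = gelem i"
      using bit3_eq_gelem by blast
    with that have "i \<noteq> 0"
      by metis
    with i have "i \<in> {1..7}" by simp
    with i(2) \<open>\<And>i. i \<in> {1..7} \<Longrightarrow> Poly_Mapping.lookup x (gelem i) = 0\<close> show ?thesis by simp
  qed
  then have "x = Poly_Mapping.single (gelem 0) (Poly_Mapping.lookup x (gelem 0))"
    by (intro poly_mapping_eqI) (auto simp: lookup_single when_def)
  with xU show "x \<in> gga_component U (gelem 0)"
    unfolding gga_component_def by blast
qed

end

section \<open>The Killing forms on V, W and S\<close>

lemma vector_4:
  "(vector [w,x,y,z] :: 'a::zero^4) $ 1 = w" "(vector [w,x,y,z] :: 'a::zero^4) $ 2 = x"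
  "(vector [w,x,y,z] :: 'a::zero^4) $ 3 = y" "(vector [w,x,y,z] :: 'a::zero^4) $ 4 = z"
  unfolding vector_def by simp_all

lemma linear_vec_nth: "Vector_Spaces.linear (*s) (*) (\<lambda>v::'a::field^'n. v $ k)"
  by unfold_locales (simp_all add: algebra_simps)

lemma vec_eq_sum_axis: "v = (\<Sum>k\<in>UNIV. v $ k *s axis k (1 :: 'a::field))"
  by (simp add: vec_eq_iff axis_def if_distrib cong: if_cong)

text \<open>In the standard basis each of the six traces equals
  \<open>- 2 * std_form r s\<close>.\<close>

lemma killing_V_eq:
  "killing_V x y = - 12 *
    (\<Sum>i\<in>{1..7}. std_form (Poly_Mapping.lookup x (gelem i)) (Poly_Mapping.lookup y (gelem i)))"
  unfolding killing_V_def twist_V_def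
proof (rule killing_form_twist_of[where J = UNIV and \<phi> = "\<lambda>k v. v $ k" and e = "\<lambda>k. axis k 1"],
    goal_cases)
  case 1 show ?case by (rule vec_bilinearI) (simp_all add: vec_eq_iff forall_4 vector_4 algebra_simps)
next
  case 2 show ?case by (rule vec_bilinearI) (simp_all add: vec_eq_iff forall_4 vector_4 algebra_simps)
next
  case 3 show ?case by (rule vec_bilinearI) (simp_all add: vec_eq_iff forall_4 vector_4 algebra_simps)
next
  case 8 show ?case by (rule linear_vec_nth)
next
  case (9 i j) show ?case by (auto simp: axis_def)
next
  case (10 v) show ?case by (rule vec_eq_sum_axis)
next
  case (11 r s) show ?case
    by (simp add: sum_4 vector_4 axis_def std_form_def algebra_simps)
qed (simp_all add: gga_space_def)

text \<open>The six traces form three equal pairs, one for each Fano line. In the products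
  \<open>r $ k * s $ k\<close>, \<open>k = 1, 2, 3\<close>, a trace has coefficients
  \<open>-1, -2, -2\<close> in the first pair, \<open>-2, -1, -2\<close> in the second and
  \<open>-2, -2, -1\<close> in the third, so every coordinate receives
  \<open>2 * (- 5)\<close>.\<close>

lemma killing_W_eq:
  "killing_W x y = - 10 *
    (\<Sum>i\<in>{1..7}. std_form (Poly_Mapping.lookup x (gelem i)) (Poly_Mapping.lookup y (gelem i)))"
  unfolding killing_W_def twist_W_def
proof (rule killing_form_twist_of[where J = UNIV and \<phi> = "\<lambda>k v. v $ k" and e = "\<lambda>k. axis k 1"],
    goal_cases)
  case 1 show ?case by (rule vec_bilinearI) (simp_all add: vec_eq_iff forall_3 algebra_simps)
next
  case 2 show ?case by (rule vec_bilinearI) (simp_all add: vec_eq_iff forall_3 algebra_simps)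
next
  case 3 show ?case by (rule vec_bilinearI) (simp_all add: vec_eq_iff forall_3 algebra_simps)
next
  case 8 show ?case by (rule linear_vec_nth)
next
  case (9 i j) show ?case by (auto simp: axis_def)
next
  case (10 v) show ?case by (rule vec_eq_sum_axis)
next
  case (11 r s) show ?case
    by (simp add: sum_3 axis_def std_form_def algebra_simps)
qed (simp_all add: gga_space_def)

lemma subspace_space_S: "vec.subspace space_S"
  unfolding vec.subspace_def
proof (intro conjI ballI allI)
  fix x y :: "'a^3" and c :: 'a
  assume x: "x \<in> space_S"
  have "c *s x \<in> space_S \<longleftrightarrow> c * (x $ 1 + x $ 2 + x $ 3) = 0"
    by (simp add: space_S_def distrib_left)
  with x show "c *s x \<in> space_S"
    by (simp add: space_S_def)
  assume y: "y \<in> space_S"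
  have "x + y \<in> space_S \<longleftrightarrow> (x $ 1 + x $ 2 + x $ 3) + (y $ 1 + y $ 2 + y $ 3) = 0"
    by (simp add: space_S_def add_ac)
  with x y show "x + y \<in> space_S"
    by (simp add: space_S_def)
qed (simp add: space_S_def)

text \<open>Solved for the third coordinate, the equation of \<open>S\<close> reduces identities on
  \<open>S\<close> to polynomial identities in free coordinates.\<close>

lemma space_S_iff: "r \<in> space_S \<longleftrightarrow> r $ 3 = - r $ 1 - r $ 2"
  by (simp add: space_S_def eq_neg_iff_add_eq_0 algebra_simps)

text \<open>The value agrees with passing from W to the line W/S: on it, the three products with
  first argument \<open>s\<close> in \<open>S\<close> act as multiplication by \<open>s $ 1\<close>,
  \<open>s $ 2\<close>, \<open>s $ 3\<close>, and the six traces add up to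
  \<open>- 2 * std_form r s\<close>. Removing this from \<open>- 10\<close> leaves
  \<open>- 8\<close>.\<close>

lemma killing_S_eq:
  assumes "x \<in> gga_space space_S" "y \<in> gga_space space_S"
  shows "killing_S x y = - 8 *
    (\<Sum>i\<in>{1..7}. std_form (Poly_Mapping.lookup x (gelem i)) (Poly_Mapping.lookup y (gelem i)))"
  unfolding killing_S_def twist_W_def
\<comment> \<open>Coordinates 1 and 3 are free on \<open>S\<close> and determine coordinate 2,
  whence this basis; \<open>bool\<close> indexes its two members.\<close>
proof (rule killing_form_twist_of[where J = UNIV and \<phi> = "\<lambda>b v. if b then v $ 1 else v $ 3"
      and e = "\<lambda>b. if b then vector [1, - 1, 0] else vector [0, - 1, 1]"], goal_cases)
  case 1 show ?case by (rule vec_bilinearI) (simp_all add: vec_eq_iff forall_3 algebra_simps)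
next
  case 2 show ?case by (rule vec_bilinearI) (simp_all add: vec_eq_iff forall_3 algebra_simps)
next
  case 3 show ?case by (rule vec_bilinearI) (simp_all add: vec_eq_iff forall_3 algebra_simps)
next
  case 4 show ?case by (rule subspace_space_S)
next
  case (5 r s) then show ?case by (simp add: space_S_iff) (simp add: algebra_simps)
next
  case (7 b) show ?case by (simp add: space_S_def)
next
  case (8 b) show ?case by (cases b) (simp_all add: linear_vec_nth)
next
  case (10 v) then show ?case
    by (simp add: UNIV_bool vec_eq_iff forall_3 space_S_iff)
next
  case (11 r s) then show ?case
    by (simp add: space_S_iff UNIV_bool std_form_def sum_3) (simp add: algebra_simps)
qed (use assms in simp_all)

section \<open>Nondegeneracy and the characteristic\<close>

lemma std_form_nondegenerate:
  assumes "\<And>s. std_form r s = 0" shows "r = 0"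
proof -
  have "r $ k = std_form r (axis k 1)" for k
    by (simp add: std_form_def axis_def if_distrib cong: if_cong)
  with assms show ?thesis by (simp add: vec_eq_iff)
qed

text \<open>The vectors orthogonal to \<open>S\<close> are the multiples of
  \<open>(1, 1, 1)\<close>, and for \<open>3 \<noteq> 0\<close> only the zero multiple has
  coordinate sum 0.\<close>

lemma std_form_nondegenerate_space_S:
  assumes "(3 :: 'a::field) \<noteq> 0" and r: "r \<in> space_S"
    and z: "\<And>s. s \<in> space_S \<Longrightarrow> std_form r s = (0 :: 'a)"
  shows "r = 0"
proof -
  have "vector [1, - 1, 0] \<in> (space_S :: ('a^3) set)" "vector [0, 1, - 1] \<in> (space_S :: ('a^3) set)"
    by (simp_all add: space_S_def)
  from this[THEN z] have eq: "r $ 1 = r $ 2" "r $ 2 = r $ 3"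
    by (simp_all add: std_form_def sum_3)
  with r have "3 * r $ 3 = 0"
    by (simp add: space_S_def algebra_simps)
  with assms(1) eq show ?thesis
    by (simp add: vec_eq_iff forall_3)
qed

text \<open>If \<open>of_nat p\<close> were 0, the characteristic would divide the prime
  \<open>p\<close>; it is not 1, so it would be \<open>p\<close>.\<close>

lemma CHAR_neq_prime:
  assumes "prime p" "CHAR('a::field) \<noteq> p"
  shows "of_nat p \<noteq> (0 :: 'a)"
  using assms CHAR_not_1'[where 'a = 'a] by (auto simp: of_nat_eq_0_iff_char_dvd prime_nat_iff)

theorem proposition2p8:
  assumes "CHAR('a::field) \<noteq> 2" and "CHAR('a) \<noteq> 3"
  shows
    "(\<forall>i\<in>{1..7}. \<forall>j\<in>{1..7}. \<forall>r s :: 'a^4.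
        killing_V (Poly_Mapping.single (gelem i) r) (Poly_Mapping.single (gelem j) s) =
          - 12 * std_form r s * (if i = j then 1 else 0)) \<and>
     (\<forall>i\<in>{1..7}. \<forall>j\<in>{1..7}. \<forall>r s :: 'a^3.
        killing_W (Poly_Mapping.single (gelem i) r) (Poly_Mapping.single (gelem j) s) =
          - 10 * std_form r s * (if i = j then 1 else 0)) \<and>
     (\<forall>i\<in>{1..7}. \<forall>j\<in>{1..7}. \<forall>r\<in>space_S. \<forall>s\<in>space_S :: ('a^3) set.
        killing_S (Poly_Mapping.single (gelem i) r) (Poly_Mapping.single (gelem j) s) =
          - 8 * std_form r s * (if i = j then 1 else 0)) \<and>
     (gga_component (UNIV :: ('a^4) set) (gelem 0) = form_radical (gga_space UNIV) killing_V) \<and>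
     (gga_component (UNIV :: ('a^3) set) (gelem 0) \<subseteq> form_radical (gga_space UNIV) killing_W) \<and>
     (CHAR('a) \<noteq> 5 \<longrightarrow>
        gga_component (UNIV :: ('a^3) set) (gelem 0) = form_radical (gga_space UNIV) killing_W) \<and>
     (gga_component (space_S :: ('a^3) set) (gelem 0) = form_radical (gga_space space_S) killing_S)"
proof -
  have n2: "(2 :: 'a) \<noteq> 0" and n3: "(3 :: 'a) \<noteq> 0"
    using CHAR_neq_prime[of 2, where 'a = 'a] CHAR_neq_prime[of 3, where 'a = 'a] assms by simp_all
  \<comment> \<open>These factorizations reduce nonvanishing of the three constants to that of 2, 3
    and, for \<open>- 10\<close>, also 5.\<close>
  have "(- 12 :: 'a) = - (2 * 2 * 3)" "(- 8 :: 'a) = - (2 * 2 * 2)" "(- 10 :: 'a) = - (2 * 5)"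
    by simp_all
  moreover have "(5 :: 'a) \<noteq> 0" if "CHAR('a) \<noteq> 5"
    using CHAR_neq_prime[of 5, where 'a = 'a] that by simp
  ultimately have n12: "(- 12 :: 'a) \<noteq> 0" and n8: "(- 8 :: 'a) \<noteq> 0"
    and n10: "CHAR('a) \<noteq> 5 \<Longrightarrow> (- 10 :: 'a) \<noteq> 0"
    using n2 n3 by (metis mult_eq_0_iff neg_equal_0_iff_equal)+
  have S0: "0 \<in> (space_S :: ('a^3) set)"
    by (simp add: space_S_def)
  show ?thesis
  proof (intro conjI ballI allI impI, goal_cases)
    case (1 i j r s)
    then show ?case by (intro form_single[OF killing_V_eq UNIV_I]) simp_all
  next
    case (2 i j r s)
    then show ?case by (intro form_single[OF killing_W_eq UNIV_I]) simp_all
  next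
    case (3 i j r s)
    then show ?case by (intro form_single[OF killing_S_eq S0]) simp_all
  next
    case 4
    show ?case
      by (rule component_eq_radical[OF killing_V_eq UNIV_I n12]) (simp add: std_form_nondegenerate)
  next
    case 5
    show ?case by (rule component_subset_radical[OF killing_W_eq UNIV_I])
  next
    case 6
    show ?case
      by (rule component_eq_radical[OF killing_W_eq UNIV_I n10[OF 6]])
        (simp add: std_form_nondegenerate)
  next
    case 7
    show ?case
      by (rule component_eq_radical[OF killing_S_eq S0 n8])
        (simp_all add: std_form_nondegenerate_space_S[OF n3])
  qed
qed

end
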